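(* Let $H$ be the system defined in the context, and suppose the underlying graph is complete on $N\ge 2$ nodes (every pair $i\neq k$ joined by an edge with susceptance $b_{ik}>0$). Let $\underline{b}$ be the arithmetic mean of the $N(N-1)/2$ edge susceptances and $b_{\min}=\min_{i\ne k}b_{ik}$. Then $$\frac{\alpha}{2}(N-1)\left(\frac{1}{k_P}+\frac{1}{\tau_Q\left(\frac{c_Q}{Nb_{\min}}+k_Q\right)}\right)\ \le\ \|H\|_2^2\ \le\ \frac{\alpha}{2}(N-1)\left(\frac{1}{k_P}+\frac{1}{\tau_Q\left(\frac{c_Q}{N\underline{b}}+k_Q\right)}\right),$$ and if all $b_{ik}$ are equal both inequalities are equalities.
   Context: $L_B$ is the weighted Laplacian of the graph with edge weights $b_{ik}$. Parameters: $k_P,\tau_P,k_Q,\tau_Q>0$, $\bar b\ge 0$, $c_Q=1+2k_Q\bar b$, $\alpha>0$. $H$ is the LTI system with state $\psi=(\delta,\omega,V)\in\mathbb{R}^{3N}$, input $\mathrm{w}\in\mathbb{R}^{2N}$, output $y$: $$\dot\psi=\begin{bmatrix}0 & I & 0\\ -\frac{k_P}{\tau_P}L_B & -\frac{1}{\tau_P}I & 0\\ 0 & 0 & -\frac{c_Q}{\tau_Q}I-\frac{k_Q}{\tau_Q}L_B\end{bmatrix}\psi+\begin{bmatrix}0&0\\ \frac{1}{\tau_P}I & 0\\ 0 & \frac{1}{\tau_Q}I\end{bmatrix}\mathrm{w},\qquad y=\begin{bmatrix}\sqrt{\alpha}L_B^{1/2} & 0 & 0\\ 0&0&\sqrt{\alpha}L_B^{1/2}\end{bmatrix}\psi,$$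 and $\|H\|_2^2$ is the squared $\mathcal{H}_2$ norm of its transfer function (finite since the single zero mode is unobservable and all other modes are stable). *)

theory Defs
  imports "HOL-Analysis.Analysis"
begin

definition laplacian :: "('n::finite \<Rightarrow> 'n \<Rightarrow> real) \<Rightarrow> real^'n^'n" where
  "laplacian b = (\<chi> i k. if i = k then (\<Sum>j\<in>UNIV - {i}. b i j) else - b i k)"

definition psd_sqrt :: "real^'n::finite^'n \<Rightarrow> real^'n^'n" where
  "psd_sqrt M = (SOME S. transpose S = S \<and> (\<forall>x. 0 \<le> x \<bullet> (S *v x)) \<and> S ** S = M)"

primrec matpow :: "real^'n::finite^'n \<Rightarrow> nat \<Rightarrow> real^'n^'n" where
  "matpow A 0 = mat 1"
| "matpow A (Suc k) = A ** matpow A k"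

definition mat_exp :: "real^'n::finite^'n \<Rightarrow> real^'n^'n" where
  "mat_exp A = suminf (\<lambda>k. scaleR (1 / (fact k :: real)) (matpow A k))"

text \<open>Squared H2 norm of the LTI system (A,B,C) (no feedthrough), defined as the
  squared L2 norm of its impulse response  t \<mapsto> C e^{At} B  on [0,\<infinity>)
  (Frobenius norm; equal to the frequency-domain definition by Parseval).\<close>
definition h2_norm_sq :: "real^'s::finite^'s \<Rightarrow> real^'i::finite^'s \<Rightarrow> real^'s^'o::finite \<Rightarrow> real" where
  "h2_norm_sq A B C = integral {0..} (\<lambda>t. (norm (C ** mat_exp (scaleR t A) ** B))\<^sup>2)"

text \<open>State index: Inl i = delta_i, Inr (Inl i) = omega_i, Inr (Inr i) = V_i.
  Input index: Inl i = first block (P), Inr i = second block (Q). Output likewise.\<close>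
definition sysA :: "real \<Rightarrow> real \<Rightarrow> real \<Rightarrow> real \<Rightarrow> real \<Rightarrow> real^'n::finite^'n
    \<Rightarrow> real^('n + 'n + 'n)^('n + 'n + 'n)" where
  "sysA kP tP kQ tQ cQ L = (\<chi> r c. case (r, c) of
      (Inl i, Inr (Inl k)) \<Rightarrow> (if i = k then 1 else 0)
    | (Inr (Inl i), Inl k) \<Rightarrow> - (kP / tP) * L $ i $ k
    | (Inr (Inl i), Inr (Inl k)) \<Rightarrow> (if i = k then - 1 / tP else 0)
    | (Inr (Inr i), Inr (Inr k)) \<Rightarrow> (if i = k then - cQ / tQ else 0) - (kQ / tQ) * L $ i $ k
    | _ \<Rightarrow> 0)"

definition sysB :: "real \<Rightarrow> real \<Rightarrow> real^('n::finite + 'n)^('n + 'n + 'n)" where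
  "sysB tP tQ = (\<chi> r c. case (r, c) of
      (Inr (Inl i), Inl k) \<Rightarrow> (if i = k then 1 / tP else 0)
    | (Inr (Inr i), Inr k) \<Rightarrow> (if i = k then 1 / tQ else 0)
    | _ \<Rightarrow> 0)"

definition sysC :: "real \<Rightarrow> real^'n::finite^'n \<Rightarrow> real^('n + 'n + 'n)^('n + 'n)" where
  "sysC \<alpha> L = (\<chi> r c. case (r, c) of
      (Inl i, Inl k) \<Rightarrow> sqrt \<alpha> * psd_sqrt L $ i $ k
    | (Inr i, Inr (Inr k)) \<Rightarrow> sqrt \<alpha> * psd_sqrt L $ i $ k
    | _ \<Rightarrow> 0)"

end

theory Submission
  imports Defs "HOL-Real_Asymp.Real_Asymp"
begin

text \<open>Projecting the trajectories on an orthonormal eigenbasis of the Laplacian decouples the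
  system into scalar equations, one second-order and one first-order equation per eigenvalue
  \<open>\<mu>\<close>, whose output energies are given by quadratic Lyapunov functions. The zero mode does not reach the
  output, so \<open>\<parallel>H\<parallel>\<^sup>2 = \<alpha>/2 \<Sum> (1/k_P + 1/(\<tau>_Q (c_Q/\<mu> + k_Q)))\<close>, summed over the \<open>N - 1\<close> other modes. The summand is
  increasing and concave in \<open>\<mu>\<close>. On a complete graph \<open>\<mu> \<ge> N b_min\<close>, as the Laplacian dominates
  \<open>b_min (N I - J)\<close>, while the trace shows that the mean of these \<open>\<mu>\<close> is \<open>N\<close> times the mean
  susceptance, and Jensen's inequality applies.\<close>

section \<open>Orthonormal eigenbases\<close>

text \<open>The polynomial has value 0, hence a minimum, at \<open>t = 0\<close>, so its derivative
  \<open>2 * p\<close> there vanishes.\<close>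

lemma quadratic_nonneg_imp_linear_coeff_zero:
  fixes p q :: real
  assumes "\<And>t. 0 \<le> 2 * t * p + t\<^sup>2 * q"
  shows "p = 0"
proof (rule ccontr)
  assume p: "p \<noteq> 0"
  \<comment> \<open>A minimiser would be \<open>- p / q\<close>; the denominator
    \<open>\<bar>q\<bar> + 1\<close> is positive for every sign of \<open>q\<close>, and the value
    at \<open>s\<close> is still negative.\<close>
  define s where "s = - p / (\<bar>q\<bar> + 1)"
  have s: "p = - (s * (\<bar>q\<bar> + 1))"
    by (simp add: s_def add_nonneg_eq_0_iff)
  have s2: "s\<^sup>2 > 0"
    using p by (auto simp: s_def add_nonneg_eq_0_iff)
  have "2 * s * p + s\<^sup>2 * q = - 2 * s\<^sup>2 * (\<bar>q\<bar> + 1) + s\<^sup>2 * q"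
    by (simp add: s power2_eq_square algebra_simps)
  also have "\<dots> = s\<^sup>2 * (q - 2 * \<bar>q\<bar> - 2)"
    by (simp add: algebra_simps)
  also have "\<dots> < 0"
    using s2 by (intro mult_pos_neg) auto
  finally show False
    using assms[of s] by simp
qed

text \<open>The maximiser of the Rayleigh quotient on the unit sphere of \<open>S\<close> is an eigenvector: the
  first variation of the nonnegative form \<open>\<mu> \<bar>x\<bar>\<^sup>2 - x \<bullet> f x\<close> vanishes at its zero.\<close>

lemma selfadjoint_eigenvector_exists:
  fixes f :: "'a::euclidean_space \<Rightarrow> 'a"
  assumes lin: "linear f" and sa: "\<And>x y. x \<bullet> f y = f x \<bullet> y"
    and S: "subspace S" and inv: "f ` S \<subseteq> S" and nontriv: "S \<noteq> {0}"
  obtains u where "u \<in> S" "norm u = 1" "f u = (u \<bullet> f u) *\<^sub>R u"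
proof -
  have cont: "continuous_on (S \<inter> sphere 0 1) (\<lambda>x. x \<bullet> f x)"
    using lin by (intro continuous_intros linear_continuous_on) (simp add: linear_conv_bounded_linear)
  have cpt: "compact (S \<inter> sphere 0 1)"
    using closed_subspace[OF S] by (simp add: closed_Int_compact)
  obtain w where w: "w \<in> S" "w \<noteq> 0"
    using nontriv subspace_0[OF S] by blast
  have "w /\<^sub>R norm w \<in> S \<inter> sphere 0 1"
    using w S by (simp add: subspace_scale)
  then obtain u where u: "u \<in> S \<inter> sphere 0 1"
    and max: "\<And>y. y \<in> S \<inter> sphere 0 1 \<Longrightarrow> y \<bullet> f y \<le> u \<bullet> f u"
    using continuous_attains_sup[OF cpt _ cont] by blast
  define \<mu> where "\<mu> = u \<bullet> f u"
  define q where "q = (\<lambda>x. \<mu> * (x \<bullet> x) - x \<bullet> f x)"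
  have uu: "u \<bullet> u = 1"
    using u by (simp add: dot_square_norm)
  have q_nonneg: "0 \<le> q x" if "x \<in> S" for x
  proof (cases "x = 0")
    case False
    have "(x /\<^sub>R norm x) \<bullet> f (x /\<^sub>R norm x) \<le> \<mu>"
      unfolding \<mu>_def using max[of "x /\<^sub>R norm x"] that S False by (simp add: subspace_scale)
    then have "(x \<bullet> f x) / (x \<bullet> x) \<le> \<mu>"
      by (simp add: linear_scale[OF lin] dot_square_norm power2_eq_square divide_simps)
    then show ?thesis
      using False by (simp add: q_def pos_divide_le_eq)
  qed (simp add: q_def)
  have "w \<bullet> (\<mu> *\<^sub>R u - f u) = 0" if w: "w \<in> S" for w
  proof (rule quadratic_nonneg_imp_linear_coeff_zero)
    fix t :: real
    have "u + t *\<^sub>R w \<in> S"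
      using u w S by (simp add: subspace_add subspace_scale)
    then have "0 \<le> q (u + t *\<^sub>R w)"
      by (rule q_nonneg)
    also have "f u \<bullet> w = u \<bullet> f w"
      by (rule sa[symmetric])
    then have "q (u + t *\<^sub>R w) = 2 * t * (w \<bullet> (\<mu> *\<^sub>R u - f u)) + t\<^sup>2 * q w"
      using uu by (simp add: q_def linear_add[OF lin] linear_scale[OF lin] inner_simps
          power2_eq_square algebra_simps inner_commute \<mu>_def)
    finally show "0 \<le> \<dots>" .
  qed
  \<comment> \<open>Invariance puts the residual itself in \<open>S\<close>; being orthogonal to all
    of \<open>S\<close>, it is orthogonal to itself.\<close>
  moreover have "\<mu> *\<^sub>R u - f u \<in> S"
    using u inv S by (auto intro: subspace_diff subspace_scale)
  ultimately have "f u = \<mu> *\<^sub>R u"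
    by (metis eq_iff_diff_eq_0 inner_eq_zero_iff)
  then show thesis
    using u by (intro that[of u]) (auto simp: \<mu>_def)
qed

text \<open>Subtracting the component along \<open>u\<close> from a vector of \<open>S\<close>
  leaves a vector of \<open>span E\<close>. This puts a split-off eigenvector back into a
  basis.\<close>

lemma span_insert_unit_normal:
  fixes u :: "'a::euclidean_space"
  assumes uu: "u \<bullet> u = 1" and u: "u \<in> S" and S: "subspace S" and E: "span E = S \<inter> {y. u \<bullet> y = 0}"
  shows "span (insert u E) = S"
proof
  have "E \<subseteq> S"
    using E span_superset by blast
  then show "span (insert u E) \<subseteq> S"
    using u S by (intro span_minimal) auto
  show "S \<subseteq> span (insert u E)"
  proof
    fix x assume "x \<in> S"
    then have "x - (u \<bullet> x) *\<^sub>R u \<in> span E"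
      using u S uu by (simp add: E subspace_diff subspace_scale inner_diff_right)
    then show "x \<in> span (insert u E)"
      by (auto simp: span_insert)
  qed
qed

text \<open>Induction on the dimension: split off a unit eigenvector \<open>u\<close>.
  Self-adjointness keeps the part of \<open>S\<close> orthogonal to \<open>u\<close> invariant, and
  its dimension is smaller. Working in an invariant subspace also lets the zero mode of a Laplacian
  be fixed in advance.\<close>

theorem selfadjoint_orthonormal_eigenbasis:
  fixes f :: "'a::euclidean_space \<Rightarrow> 'a"
  assumes lin: "linear f" and sa: "\<And>x y. x \<bullet> f y = f x \<bullet> y"
    and "subspace S" and "f ` S \<subseteq> S"
  shows "\<exists>E. E \<subseteq> S \<and> pairwise orthogonal E \<and> (\<forall>v\<in>E. norm v = 1 \<and> f v = (v \<bullet> f v) *\<^sub>R v) \<and> span E = S"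
  using assms(3,4)
proof (induction "dim S" arbitrary: S rule: less_induct)
  case less
  show ?case
  proof (cases "S = {0}")
    case True
    then show ?thesis by (intro exI[of _ "{}"]) auto
  next
    case False
    obtain u where u: "u \<in> S" "norm u = 1" "f u = (u \<bullet> f u) *\<^sub>R u"
      using selfadjoint_eigenvector_exists[OF lin sa less.prems False] by blast
    define T where "T = S \<inter> {y. u \<bullet> y = 0}"
    have uu: "u \<bullet> u = 1"
      using u by (simp add: dot_square_norm)
    have T: "subspace T"
      unfolding T_def using less.prems(1) subspace_hyperplane by (rule subspace_inter)
    have "T \<subseteq> S" "u \<notin> T"
      by (simp_all add: T_def uu)
    then have "T \<subset> S"
      using u by blast
    then have "dim T < dim S"
      using T less.prems(1) by (metis dim_psubset span_eq_iff)
    moreover have "f ` T \<subseteq> T"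
    proof -
      have "u \<bullet> f y = 0" if "y \<in> T" for y
        using that by (subst sa, subst u(3)) (simp add: T_def)
      then show ?thesis
        using less.prems(2) by (auto simp: T_def)
    qed
    ultimately obtain E where E: "E \<subseteq> T" "pairwise orthogonal E"
      "\<forall>v\<in>E. norm v = 1 \<and> f v = (v \<bullet> f v) *\<^sub>R v" "span E = T"
      using less.hyps T by blast
    have "span (insert u E) = S"
      using span_insert_unit_normal[OF uu u(1) less.prems(1)] E(4) by (simp add: T_def)
    moreover have "pairwise orthogonal (insert u E)"
      using E(1,2) by (auto simp: pairwise_insert T_def orthogonal_def inner_commute)
    ultimately show ?thesis
      using u E by (intro exI[of _ "insert u E"]) (auto simp: T_def)
  qed
qed

section \<open>Orthonormal bases, Parseval's identity and the trace\<close>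

definition orthonormal_basis :: "'a::euclidean_space set \<Rightarrow> bool" where
  "orthonormal_basis E \<longleftrightarrow> pairwise orthogonal E \<and> (\<forall>v\<in>E. norm v = 1) \<and> span E = UNIV"

lemma orthonormal_basis_finite_independent:
  assumes "orthonormal_basis E"
  shows "finite E" "independent E"
proof -
  have "0 \<notin> E"
    using assms by (force simp: orthonormal_basis_def)
  then show "independent E"
    using assms by (simp add: orthonormal_basis_def pairwise_orthogonal_independent)
  then show "finite E"
    by (rule independent_imp_finite)
qed

lemma orthonormal_basis_card:
  fixes E :: "'a::euclidean_space set"
  assumes "orthonormal_basis E"
  shows "card E = DIM('a)"
  using dim_span_eq_card_independent[OF orthonormal_basis_finite_independent(2)[OF assms]] assms
  by (metis dim_UNIV dim_span orthonormal_basis_def)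

lemma parseval:
  fixes x y :: "'a::euclidean_space"
  assumes E: "orthonormal_basis E"
  shows "x \<bullet> y = (\<Sum>v\<in>E. (v \<bullet> x) * (v \<bullet> y))"
proof -
  have "x \<bullet> y = (\<Sum>v\<in>E. (x \<bullet> v) *\<^sub>R v) \<bullet> y"
    using orthonormal_basis_expand[of E x] orthonormal_basis_finite_independent[OF E] E
    by (simp add: orthonormal_basis_def)
  also have "\<dots> = (\<Sum>v\<in>E. (v \<bullet> x) * (v \<bullet> y))"
    by (subst inner_sum_left) (simp add: inner_commute)
  finally show ?thesis .
qed

text \<open>Parseval for two standard basis vectors: a square matrix with orthonormal columns has
  orthonormal rows.\<close>

lemma parseval_component:
  fixes E :: "(real^'n::finite) set"
  assumes E: "orthonormal_basis E"
  shows "(\<Sum>v\<in>E. v $ i * v $ j) = (if i = j then 1 else 0)"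
proof -
  have "(\<Sum>v\<in>E. v $ i * v $ j) = axis i 1 \<bullet> (axis j 1 :: real^'n)"
    by (subst parseval[OF E]) (simp add: inner_axis del: inner_axis_axis)
  then show ?thesis
    by (simp add: inner_axis_axis)
qed

text \<open>Basis invariance of the trace: after exchanging the sums, row orthonormality leaves only
  the diagonal entries.\<close>

lemma trace_eq_sum_quadratic_form:
  fixes L :: "real^'n::finite^'n"
  assumes E: "orthonormal_basis E"
  shows "(\<Sum>v\<in>E. v \<bullet> (L *v v)) = trace L"
proof -
  have "(\<Sum>v\<in>E. v \<bullet> (L *v v)) = (\<Sum>v\<in>E. \<Sum>i\<in>UNIV. \<Sum>j\<in>UNIV. L $ i $ j * (v $ i * v $ j))"
    by (simp add: inner_vec_def matrix_vector_mult_def sum_distrib_left ac_simps)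
  also have "\<dots> = (\<Sum>i\<in>UNIV. \<Sum>j\<in>UNIV. L $ i $ j * (\<Sum>v\<in>E. v $ i * v $ j))"
    by (subst sum.swap, rule sum.cong[OF refl], subst sum.swap) (simp add: sum_distrib_left)
  also have "\<dots> = trace L"
    by (simp add: parseval_component[OF E] trace_def if_distrib cong: if_cong)
  finally show ?thesis .
qed

lemma symmetric_matrix_selfadjoint:
  fixes L :: "real^'n::finite^'n"
  assumes "transpose L = L"
  shows "x \<bullet> (L *v y) = (L *v x) \<bullet> y"
  by (metis assms dot_lmul_matrix transpose_matrix_vector)

text \<open>Since \<^const>\<open>psd_sqrt\<close> is a choice operator, existence of a square root gives its properties.\<close>

lemma psd_sqrt:
  fixes L :: "real^'n::finite^'n"
  assumes sym: "transpose L = L"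
    and E: "orthonormal_basis E"
    and eig: "\<And>v. v \<in> E \<Longrightarrow> L *v v = (v \<bullet> (L *v v)) *\<^sub>R v"
    and psd: "\<And>v. v \<in> E \<Longrightarrow> 0 \<le> v \<bullet> (L *v v)"
  shows "transpose (psd_sqrt L) = psd_sqrt L" "psd_sqrt L ** psd_sqrt L = L"
proof -
  define \<mu> where "\<mu> = (\<lambda>v. v \<bullet> (L *v v))"
  \<comment> \<open>The spectral square root: the sum of \<open>sqrt (\<mu> v)\<close> times the
    orthogonal projection onto \<open>v\<close>.\<close>
  define S where "S = (\<chi> i j. \<Sum>v\<in>E. sqrt (\<mu> v) * (v $ i * v $ j))"
  have finE: "finite E"
    using orthonormal_basis_finite_independent[OF E] by blast
  have Sx: "S *v x = (\<Sum>v\<in>E. (sqrt (\<mu> v) * (v \<bullet> x)) *\<^sub>R v)" for x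
    by (simp add: vec_eq_iff S_def matrix_vector_mult_def inner_vec_def sum_distrib_left
        sum_distrib_right, subst sum.swap, simp add: ac_simps)
  have inner_S: "v \<bullet> (S *v x) = sqrt (\<mu> v) * (v \<bullet> x)" if v: "v \<in> E" for v x
  proof -
    have "v \<bullet> w = (if w = v then 1 else 0)" if "w \<in> E" for w
      using v that E by (auto simp: orthonormal_basis_def pairwise_def orthogonal_def dot_square_norm)
    then have "v \<bullet> (S *v x) = (\<Sum>w\<in>E. if w = v then sqrt (\<mu> w) * (w \<bullet> x) else 0)"
      unfolding Sx inner_sum_right by (intro sum.cong) auto
    then show ?thesis
      using v finE by simp
  qed
  have "transpose S = S"
    by (simp add: S_def transpose_def vec_eq_iff mult.commute mult.left_commute)
  moreover have "0 \<le> x \<bullet> (S *v x)" for x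
    unfolding parseval[OF E, of x "S *v x"]
    using psd by (intro sum_nonneg) (simp add: inner_S \<mu>_def mult.left_commute[of "v \<bullet> x" for v])
  moreover have "S ** S = L"
  proof -
    \<comment> \<open>Both matrices multiply the coordinate along \<open>v\<close> by
      \<open>\<mu> v\<close>, so Parseval identifies them.\<close>
    have "y \<bullet> ((S ** S) *v x) = y \<bullet> (L *v x)" for x y
    proof -
      have "v \<bullet> ((S ** S) *v x) = v \<bullet> (L *v x)" if v: "v \<in> E" for v
      proof -
        have "v \<bullet> (L *v x) = \<mu> v * (v \<bullet> x)"
          using eig[OF v] symmetric_matrix_selfadjoint[OF sym, of v x]
          by (metis \<mu>_def inner_scaleR_left)
        moreover have "v \<bullet> ((S ** S) *v x) = sqrt (\<mu> v) * (sqrt (\<mu> v) * (v \<bullet> x))"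
          by (simp only: matrix_vector_mul_assoc[symmetric] inner_S[OF v])
        moreover have "sqrt (\<mu> v) * sqrt (\<mu> v) = \<mu> v"
          using psd[OF v] by (simp add: \<mu>_def)
        ultimately show ?thesis
          by (simp add: mult.assoc[symmetric])
      qed
      then show ?thesis
        by (subst (1 2) parseval[OF E]) simp
    qed
    then show ?thesis
      unfolding matrix_eq by (auto intro: vector_eq_ldot[THEN iffD1])
  qed
  ultimately have "\<exists>S. transpose S = S \<and> (\<forall>x. 0 \<le> x \<bullet> (S *v x)) \<and> S ** S = L"
    by blast
  from someI_ex[OF this] show "transpose (psd_sqrt L) = psd_sqrt L" "psd_sqrt L ** psd_sqrt L = L"
    unfolding psd_sqrt_def by blast+
qed

section \<open>Matrix exponential and Lyapunov integrals\<close>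

text \<open>The sum of all absolute entries dominates every row sum, so each further factor
  \<open>A\<close> costs at most one factor of it. This gives the entrywise series an exponential
  majorant.\<close>

lemma abs_matpow_le:
  fixes A :: "real^'n::finite^'n"
  shows "\<bar>matpow A k $ i $ j\<bar> \<le> (\<Sum>i\<in>UNIV. \<Sum>j\<in>UNIV. \<bar>A $ i $ j\<bar>) ^ k"
proof (induction k arbitrary: i)
  case 0
  then show ?case by (simp add: mat_def)
next
  case (Suc k)
  let ?K = "\<Sum>i\<in>UNIV. \<Sum>j\<in>UNIV. \<bar>A $ i $ j\<bar>"
  have "\<bar>matpow A (Suc k) $ i $ j\<bar> \<le> (\<Sum>l\<in>UNIV. \<bar>A $ i $ l\<bar> * \<bar>matpow A k $ l $ j\<bar>)"
    by (simp add: matrix_matrix_mult_def abs_mult order_trans[OF sum_abs])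
  also have "\<dots> \<le> (\<Sum>l\<in>UNIV. \<bar>A $ i $ l\<bar> * ?K ^ k)"
    by (intro sum_mono mult_left_mono Suc.IH) auto
  also have "\<dots> = (\<Sum>l\<in>UNIV. \<bar>A $ i $ l\<bar>) * ?K ^ k"
    by (simp add: sum_distrib_right)
  also have "\<dots> \<le> ?K * ?K ^ k"
    by (intro mult_right_mono member_le_sum zero_le_power sum_nonneg) auto
  finally show ?case by simp
qed

lemma summable_matpow_component:
  fixes A :: "real^'n::finite^'n"
  shows "summable (\<lambda>k. (matpow A k $ i $ j / fact k) * t ^ k)"
proof (rule summable_comparison_test)
  let ?K = "\<Sum>i\<in>UNIV. \<Sum>j\<in>UNIV. \<bar>A $ i $ j\<bar>"
  show "summable (\<lambda>k. (?K * \<bar>t\<bar>) ^ k /\<^sub>R fact k)"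
    by (rule summable_exp_generic)
  show "\<exists>N. \<forall>k\<ge>N. norm ((matpow A k $ i $ j / fact k) * t ^ k) \<le> (?K * \<bar>t\<bar>) ^ k /\<^sub>R fact k"
    using abs_matpow_le[of A _ i j]
    by (auto simp: abs_mult power_abs power_mult_distrib divide_simps intro!: exI[of _ 0] mult_right_mono)
qed

lemma matpow_scaleR: "matpow (t *\<^sub>R A) k = t ^ k *\<^sub>R matpow A k"
  by (induction k) (simp_all add: vec_eq_iff matrix_matrix_mult_def sum_distrib_left ac_simps)

text \<open>Entrywise, the matrix exponential is a scalar power series in \<open>t\<close>, which
  can be differentiated term by term.\<close>

lemma mat_exp_component:
  fixes A :: "real^'n::finite^'n"
  shows "mat_exp (t *\<^sub>R A) $ i $ j = (\<Sum>k. (matpow A k $ i $ j / fact k) * t ^ k)"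
proof -
  have "(\<lambda>k. (1 / (fact k :: real)) *\<^sub>R matpow (t *\<^sub>R A) k) sums
      (\<chi> i j. \<Sum>k. (matpow A k $ i $ j / fact k) * t ^ k)"
    unfolding sums_def
  proof (intro vec_tendstoI)
    fix i j
    show "(\<lambda>n. (\<Sum>k<n. (1 / (fact k :: real)) *\<^sub>R matpow (t *\<^sub>R A) k) $ i $ j) \<longlonglongrightarrow>
        (\<chi> i j. \<Sum>k. (matpow A k $ i $ j / fact k) * t ^ k) $ i $ j"
      using summable_LIMSEQ[OF summable_matpow_component[of A i j t]]
      by (simp add: matpow_scaleR mult.commute)
  qed
  then show ?thesis
    by (simp add: mat_exp_def sums_unique[symmetric])
qed

lemma mat_exp_0: "mat_exp (0 *\<^sub>R A) = mat 1"
proof -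
  have "(\<Sum>k. (matpow A k $ i $ j / fact k) * 0 ^ k) = mat 1 $ i $ j" for i j
    using powser_zero[of "\<lambda>k. matpow A k $ i $ j / fact k"] by simp
  then show ?thesis
    by (simp only: vec_eq_iff mat_exp_component) simp
qed

lemma has_derivative_mat_exp_component:
  fixes A :: "real^'n::finite^'n"
  shows "((\<lambda>t. mat_exp (t *\<^sub>R A) $ i $ j) has_field_derivative (A ** mat_exp (t *\<^sub>R A)) $ i $ j) (at t)"
proof -
  let ?c = "\<lambda>l k. matpow A k $ l $ j / fact k"
  have "((\<lambda>t. \<Sum>k. ?c i k * t ^ k) has_field_derivative (\<Sum>k. diffs (?c i) k * t ^ k)) (at t)"
    using summable_matpow_component by (rule termdiffs_strong_converges_everywhere)
  also have "(\<lambda>t. \<Sum>k. ?c i k * t ^ k) = (\<lambda>t. mat_exp (t *\<^sub>R A) $ i $ j)"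
    by (simp add: mat_exp_component)
  also have "(\<Sum>k. diffs (?c i) k * t ^ k) = (\<Sum>k. \<Sum>l\<in>UNIV. A $ i $ l * (?c l k * t ^ k))"
  proof (rule suminf_cong)
    fix k
    \<comment> \<open>\<open>diffs\<close> multiplies the coefficient of index \<open>k + 1\<close>
      by \<open>k + 1\<close>, which turns \<open>fact (Suc k)\<close> into \<open>fact k\<close>;
      the extra factor \<open>A\<close> stands on the left, as in \<open>matpow\<close>.\<close>
    have "diffs (?c i) k = matpow A (Suc k) $ i $ j / fact k"
      by (simp add: diffs_def divide_simps del: matpow.simps)
    also have "\<dots> = (\<Sum>l\<in>UNIV. A $ i $ l * ?c l k)"
      by (simp add: matrix_matrix_mult_def sum_divide_distrib)
    finally show "diffs (?c i) k * t ^ k = (\<Sum>l\<in>UNIV. A $ i $ l * (?c l k * t ^ k))"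
      by (simp add: sum_distrib_right mult.assoc)
  qed
  also have "\<dots> = (\<Sum>l\<in>UNIV. \<Sum>k. A $ i $ l * (?c l k * t ^ k))"
    by (intro suminf_sum summable_mult summable_matpow_component)
  also have "\<dots> = (\<Sum>l\<in>UNIV. A $ i $ l * (\<Sum>k. ?c l k * t ^ k))"
    by (intro sum.cong refl suminf_mult summable_matpow_component)
  also have "\<dots> = (A ** mat_exp (t *\<^sub>R A)) $ i $ j"
    by (simp only: matrix_matrix_mult_def mat_exp_component vec_lambda_beta)
  finally show ?thesis .
qed

lemma has_derivative_mat_exp_trajectory:
  fixes A :: "real^'n::finite^'n" and x :: "real^'n"
  shows "((\<lambda>t. (mat_exp (t *\<^sub>R A) *v x) $ i) has_field_derivative
    (A *v (mat_exp (t *\<^sub>R A) *v x)) $ i) (at t)"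
proof -
  have "((\<lambda>t. \<Sum>j\<in>UNIV. mat_exp (t *\<^sub>R A) $ i $ j * x $ j) has_field_derivative
    (\<Sum>j\<in>UNIV. (A ** mat_exp (t *\<^sub>R A)) $ i $ j * x $ j)) (at t)"
    by (intro DERIV_sum DERIV_cmult_right has_derivative_mat_exp_component)
  then show ?thesis
    by (simp only: matrix_vector_mul_assoc) (simp add: matrix_vector_mult_def)
qed

text \<open>The columns of the impulse response are the responses to single-input impulses, so the
  Frobenius norm adds up their energies.\<close>

lemma norm_matrix_power2_eq_sum_columns:
  fixes M :: "real^'i::finite^'o::finite"
  shows "(norm M)\<^sup>2 = (\<Sum>j\<in>UNIV. (norm (M *v axis j 1))\<^sup>2)"
proof -
  have "(norm M)\<^sup>2 = (\<Sum>i\<in>UNIV. \<Sum>j\<in>UNIV. M $ i $ j * M $ i $ j)"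
    by (simp add: power2_norm_eq_inner inner_vec_def)
  also have "\<dots> = (\<Sum>j\<in>UNIV. \<Sum>i\<in>UNIV. M $ i $ j * M $ i $ j)"
    by (rule sum.swap)
  finally show ?thesis
    by (simp add: power2_norm_eq_inner inner_vec_def matrix_vector_mult_basis column_def)
qed

section \<open>Energies of scalar linear equations\<close>

text \<open>\<open>- F\<close> is an antiderivative of \<open>f\<close> with limit 0. The
  nonnegative Lebesgue integral allows the fundamental theorem on the half-line before integrability
  is known.\<close>

lemma has_integral_lyapunov:
  fixes F f :: "real \<Rightarrow> real"
  assumes F: "\<And>t. (F has_field_derivative - f t) (at t)" and f: "\<And>t. 0 \<le> f t"
    and cont: "continuous_on UNIV f" and lim: "(F \<longlongrightarrow> 0) at_top"
  shows "(f has_integral F 0) {0..}"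
proof -
  have G: "((\<lambda>t. - F t) has_real_derivative f t) (at t)" for t
    using DERIV_minus[OF F, of t] by simp
  have meas: "f \<in> borel_measurable borel"
    using cont by (rule borel_measurable_continuous_onI)
  then have nn: "(\<integral>\<^sup>+x. ennreal (f x) * indicator {0..} x \<partial>lborel) = ennreal (0 - (- F 0))"
    using tendsto_minus[OF lim] by (intro nn_integral_FTC_atLeast G f) auto
  \<comment> \<open>This lets \<open>ennreal (F 0)\<close> be read back as a real number;
    \<open>F\<close> is nonincreasing with limit 0.\<close>
  have "0 \<le> F 0"
  proof (rule tendsto_upperbound[OF lim])
    show "\<forall>\<^sub>F t in at_top. F t \<le> F 0"
      using eventually_ge_at_top[of 0]
    proof eventually_elim
      case (elim t)
      show ?case
        by (rule DERIV_nonpos_imp_nonincreasing[OF elim]) (meson F f neg_le_0_iff_le)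
    qed
  qed simp
  have "((\<lambda>x. f x * indicator {0..} x) has_integral F 0) UNIV"
    using meas f nn \<open>0 \<le> F 0\<close>
    by (intro nn_integral_has_integral) (auto simp: ennreal_mult' ennreal_indicator)
  also have "(\<lambda>x. f x * indicator {0..} x) = (\<lambda>x. if x \<in> {0..} then f x else 0)"
    by (auto simp: indicator_def)
  finally show ?thesis
    by (simp only: has_integral_restrict_UNIV)
qed

text \<open>Gronwall's argument: \<open>F t * exp (\<epsilon> * t)\<close> is nonincreasing.\<close>

lemma decay_tendsto_0:
  fixes F F' :: "real \<Rightarrow> real"
  assumes F: "\<And>t. (F has_field_derivative F' t) (at t)" and "0 < \<epsilon>"
    and nonneg: "\<And>t. 0 \<le> F t" and decay: "\<And>t. F' t \<le> - \<epsilon> * F t"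
  shows "(F \<longlongrightarrow> 0) at_top"
proof (rule tendsto_sandwich[OF _ _ tendsto_const])
  show "\<forall>\<^sub>F t in at_top. F t \<le> F 0 * exp (- \<epsilon> * t)"
    using eventually_ge_at_top[of 0]
  proof eventually_elim
    case (elim t)
    have "F t * exp (\<epsilon> * t) \<le> F 0 * exp (\<epsilon> * 0)"
    proof (rule DERIV_nonpos_imp_nonincreasing[OF elim])
      fix s
      have "((\<lambda>t. F t * exp (\<epsilon> * t)) has_field_derivative
          (F' s + \<epsilon> * F s) * exp (\<epsilon> * s)) (at s)"
        by (auto intro!: derivative_eq_intros F simp: algebra_simps)
      moreover have "(F' s + \<epsilon> * F s) * exp (\<epsilon> * s) \<le> 0"
        using decay[of s] by (simp add: mult_nonpos_nonneg)
      ultimately show "\<exists>y. ((\<lambda>t. F t * exp (\<epsilon> * t)) has_field_derivative y) (at s) \<and> y \<le> 0"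
        by blast
    qed
    then show ?case
      by (simp add: exp_minus field_simps)
  qed
  show "((\<lambda>t. F 0 * exp (- \<epsilon> * t)) \<longlongrightarrow> 0) at_top"
    using \<open>0 < \<epsilon>\<close> by real_asymp
qed (use nonneg in auto)

text \<open>The Lyapunov function \<open>(z t)\<^sup>2 / (2 * k)\<close> has derivative
  \<open>- (z t)\<^sup>2\<close>, which is \<open>- 2 * k\<close> times itself, so it gives both the
  value and the decay.\<close>

lemma integral_first_order_energy:
  fixes z :: "real \<Rightarrow> real"
  assumes z: "\<And>t. (z has_field_derivative - k * z t) (at t)" and k: "0 < k"
  shows "((\<lambda>t. (z t)\<^sup>2) has_integral (z 0)\<^sup>2 / (2 * k)) {0..}"
proof -
  define F where "F = (\<lambda>t. (z t)\<^sup>2 / (2 * k))"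
  have F: "(F has_field_derivative - (z t)\<^sup>2) (at t)" for t
    unfolding F_def using k
    by (auto intro!: derivative_eq_intros z simp: power2_eq_square field_simps)
  have "(F \<longlongrightarrow> 0) at_top"
    using k by (intro decay_tendsto_0[OF F, of "2 * k"]) (auto simp: F_def)
  moreover have "continuous_on UNIV (\<lambda>t. (z t)\<^sup>2)"
    using z by (intro continuous_intros continuous_at_imp_continuous_on) (auto intro: DERIV_isCont)
  ultimately show ?thesis
    using has_integral_lyapunov[OF F] by (simp add: F_def)
qed

text \<open>Both functions below are Lyapunov functions: \<open>P\<close> decays exponentially, its derivative being
  \<open>- a (y\<^sup>2 + c x\<^sup>2)\<close>, and it dominates \<open>F\<close>, whose derivative is exactly \<open>- x\<^sup>2\<close>.\<close>

lemma integral_second_order_energy: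
  fixes x y :: "real \<Rightarrow> real"
  assumes x: "\<And>t. (x has_field_derivative y t) (at t)"
    and y: "\<And>t. (y has_field_derivative - c * x t - a * y t) (at t)"
    and c: "0 < c" and a: "0 < a" and x0: "x 0 = 0"
  shows "((\<lambda>t. (x t)\<^sup>2) has_integral (y 0)\<^sup>2 / (2 * a * c)) {0..}"
proof -
  \<comment> \<open>The shift \<open>a / 2\<close> in \<open>P\<close> spreads the dissipation over
    \<open>x\<close> and \<open>y\<close>. The shift \<open>a\<close> in \<open>F\<close> absorbs
    the damping, as \<open>y + a * x\<close> has derivative \<open>- c * x\<close>.\<close>
  define P where "P = (\<lambda>t. (y t + a / 2 * x t)\<^sup>2 + (c + a\<^sup>2 / 4) * (x t)\<^sup>2)"
  define F where "F = (\<lambda>t. ((y t + a * x t)\<^sup>2 + c * (x t)\<^sup>2) / (2 * a * c))"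
  \<comment> \<open>In \<open>P\<close> the cross term \<open>a * x * y\<close> is at most
    \<open>a / 2 * (x\<^sup>2 + y\<^sup>2)\<close>. \<open>K\<close> adds the resulting coefficient
    of \<open>y\<^sup>2\<close> to that of \<open>x\<^sup>2\<close> divided by
    \<open>c\<close>.\<close>
  define K where "K = 1 + a / 2 + (a / 2 + a\<^sup>2 / 2 + c) / c"
  have K: "K > 0"
    using a c by (auto simp: K_def intro!: add_pos_pos divide_pos_pos)
  have P': "(P has_field_derivative - a * ((y t)\<^sup>2 + c * (x t)\<^sup>2)) (at t)" for t
    unfolding P_def
    by (auto intro!: derivative_eq_intros x y simp: power2_eq_square) algebra
  have F': "(F has_field_derivative - (x t)\<^sup>2) (at t)" for t
    unfolding F_def using a c
    by (auto intro!: derivative_eq_intros x y simp: power2_eq_square field_simps)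
  have P_le: "P t \<le> K * ((y t)\<^sup>2 + c * (x t)\<^sup>2)" for t
  proof -
    have "0 \<le> a / 2 * (y t - x t)\<^sup>2"
      using a by simp
    moreover have "K * c = c + a / 2 * c + (a / 2 + a\<^sup>2 / 2 + c)"
      using c by (simp add: K_def field_simps)
    then have "K * ((y t)\<^sup>2 + c * (x t)\<^sup>2) = (1 + a / 2 + (a / 2 + a\<^sup>2 / 2 + c) / c) * (y t)\<^sup>2
        + (c + a / 2 * c + (a / 2 + a\<^sup>2 / 2 + c)) * (x t)\<^sup>2"
      by (metis K_def distrib_left mult.assoc)
    moreover have "0 \<le> (a / 2 + a\<^sup>2 / 2 + c) / c * (y t)\<^sup>2" "0 \<le> (c + a / 2 * c) * (x t)\<^sup>2"
      using a c by simp_all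
    ultimately show ?thesis
      by (simp add: P_def power2_eq_square algebra_simps)
  qed
  have P_lim: "(P \<longlongrightarrow> 0) at_top"
  proof (rule decay_tendsto_0[OF P'])
    show "0 < a / K"
      using a K by simp
    show "0 \<le> P t" for t
      using c by (simp add: P_def)
    show "- a * ((y t)\<^sup>2 + c * (x t)\<^sup>2) \<le> - (a / K) * P t" for t
      using mult_left_mono[OF P_le[of t], of "a / K"] a K by simp
  qed
  have F_nonneg: "0 \<le> F t" for t
    using a c by (simp add: F_def)
  have F_le: "F t \<le> P t / (a * c)" for t
  proof -
    have "2 * P t - ((y t + a * x t)\<^sup>2 + c * (x t)\<^sup>2) = (y t)\<^sup>2 + c * (x t)\<^sup>2"
      by (simp add: P_def power2_eq_square algebra_simps)
    also have "\<dots> \<ge> 0"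
      using c by simp
    finally show ?thesis
      using a c by (simp add: F_def divide_simps)
  qed
  have "(F \<longlongrightarrow> 0) at_top"
  proof (rule tendsto_sandwich[OF _ _ tendsto_const])
    show "((\<lambda>t. P t / (a * c)) \<longlongrightarrow> 0) at_top"
      using tendsto_divide[OF P_lim tendsto_const, of "a * c"] a c by simp
  qed (use F_nonneg F_le in \<open>auto intro!: always_eventually\<close>)
  moreover have "continuous_on UNIV (\<lambda>t. (x t)\<^sup>2)"
    using x by (intro continuous_intros continuous_at_imp_continuous_on) (auto intro: DERIV_isCont)
  ultimately show ?thesis
    using has_integral_lyapunov[OF F'] by (simp add: F_def x0)
qed

section \<open>Modal form of the squared norm\<close>

lemma sum_UNIV_Plus:
  "(\<Sum>x\<in>(UNIV :: ('a::finite + 'b::finite) set). f x) = (\<Sum>a\<in>UNIV. f (Inl a)) + (\<Sum>b\<in>UNIV. f (Inr b))"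
  by (subst UNIV_Plus_UNIV[symmetric], subst sum.Plus) (auto simp: comp_def)

definition state_delta :: "real^('n + 'n + 'n) \<Rightarrow> real^'n::finite" where
  "state_delta \<psi> = (\<chi> i. \<psi> $ Inl i)"

definition state_omega :: "real^('n + 'n + 'n) \<Rightarrow> real^'n::finite" where
  "state_omega \<psi> = (\<chi> i. \<psi> $ Inr (Inl i))"

definition state_V :: "real^('n + 'n + 'n) \<Rightarrow> real^'n::finite" where
  "state_V \<psi> = (\<chi> i. \<psi> $ Inr (Inr i))"

lemmas state_defs = state_delta_def state_omega_def state_V_def

lemma sysA_mult:
  fixes L :: "real^'n::finite^'n" and kP tP kQ tQ cQ :: real
  defines A: "A \<equiv> sysA kP tP kQ tQ cQ L"
  shows "state_delta (A *v \<psi>) = state_omega \<psi>"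
    and "state_omega (A *v \<psi>) = - (kP / tP) *\<^sub>R (L *v state_delta \<psi>) - (1 / tP) *\<^sub>R state_omega \<psi>"
    and "state_V (A *v \<psi>) = - (cQ / tQ) *\<^sub>R state_V \<psi> - (kQ / tQ) *\<^sub>R (L *v state_V \<psi>)"
  by (simp_all add: A sysA_def state_defs vec_eq_iff matrix_vector_mult_def sum_UNIV_Plus
      left_diff_distrib sum_subtractf sum_distrib_left mult.assoc if_distrib[of "\<lambda>x. x * _"]
      sum_negf flip: sum_divide_distrib cong: if_cong)

text \<open>Impulse responses start with zero angles, as the second-order energy formula requires,
  and each input excites only one of the two decoupled subsystems.\<close>

lemma sysB_mult_axis:
  fixes tP tQ :: real
  shows "state_delta (sysB tP tQ *v axis j 1) = (0 :: real^'n::finite)"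
    and "state_omega (sysB tP tQ *v axis (Inl i) 1) = (1 / tP) *\<^sub>R (axis i 1 :: real^'n)"
    and "state_V (sysB tP tQ *v axis (Inl i) 1) = (0 :: real^'n)"
    and "state_omega (sysB tP tQ *v axis (Inr i) 1) = (0 :: real^'n)"
    and "state_V (sysB tP tQ *v axis (Inr i) 1) = (1 / tQ) *\<^sub>R (axis i 1 :: real^'n)"
  unfolding matrix_vector_mult_basis column_def
  by (auto simp: sysB_def state_defs vec_eq_iff axis_def split: sum.split)

text \<open>By symmetry of the root \<open>S\<close>, \<open>(S *v x) \<bullet> (S *v x)\<close>
  equals \<open>x \<bullet> (L *v x)\<close>, so the root disappears from the output energy.\<close>

lemma norm_sysC_mult:
  fixes L :: "real^'n::finite^'n"
  assumes S: "transpose (psd_sqrt L) = psd_sqrt L" "psd_sqrt L ** psd_sqrt L = L" and "0 \<le> \<alpha>"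
  shows "(norm (sysC \<alpha> L *v \<psi>))\<^sup>2 =
    \<alpha> * (state_delta \<psi> \<bullet> (L *v state_delta \<psi>) + state_V \<psi> \<bullet> (L *v state_V \<psi>))"
proof -
  let ?S = "psd_sqrt L"
  have C: "(sysC \<alpha> L *v \<psi>) $ Inl i = sqrt \<alpha> * (?S *v state_delta \<psi>) $ i"
    "(sysC \<alpha> L *v \<psi>) $ Inr i = sqrt \<alpha> * (?S *v state_V \<psi>) $ i" for i
    by (simp_all add: sysC_def matrix_vector_mult_def sum_UNIV_Plus state_defs sum_distrib_left mult.assoc)
  have S_sq: "(?S *v x) \<bullet> (?S *v x) = x \<bullet> (L *v x)" for x
    using symmetric_matrix_selfadjoint[OF S(1), of x "?S *v x"] by (simp add: matrix_vector_mul_assoc S(2))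
  have sq: "sqrt \<alpha> * y * (sqrt \<alpha> * y) = \<alpha> * (y * y)" for y
    using power_mult_distrib[of "sqrt \<alpha>" y 2] \<open>0 \<le> \<alpha>\<close> by (simp add: power2_eq_square)
  have "(norm (sysC \<alpha> L *v \<psi>))\<^sup>2 =
      \<alpha> * ((?S *v state_delta \<psi>) \<bullet> (?S *v state_delta \<psi>) + (?S *v state_V \<psi>) \<bullet> (?S *v state_V \<psi>))"
    unfolding power2_norm_eq_inner inner_vec_def sum_UNIV_Plus C
    by (simp only: inner_real_def sq sum_distrib_left distrib_left)
  then show ?thesis
    by (simp only: S_sq)
qed

lemma quadratic_form_eigenbasis:
  fixes L :: "real^'n::finite^'n"
  assumes sym: "transpose L = L" and E: "orthonormal_basis E"
    and eig: "\<And>v. v \<in> E \<Longrightarrow> L *v v = \<mu> v *\<^sub>R v"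
  shows "x \<bullet> (L *v x) = (\<Sum>v\<in>E. \<mu> v * (v \<bullet> x)\<^sup>2)"
proof -
  have "v \<bullet> (L *v x) = \<mu> v * (v \<bullet> x)" if "v \<in> E" for v
    by (simp add: symmetric_matrix_selfadjoint[OF sym] eig that)
  then show ?thesis
    by (subst parseval[OF E]) (simp add: power2_eq_square ac_simps)
qed

text \<open>Along \<open>v\<close>, angle and frequency obey the second-order equation with
  \<open>c = kP * \<mu> v / tP\<close> and \<open>a = 1 / tP\<close>, and the voltage decays at rate
  \<open>(cQ + kQ * \<mu> v) / tQ\<close>. The output weights both energies by
  \<open>\<mu> v\<close>.\<close>

lemma has_integral_output_energy:
  fixes L :: "real^'n::finite^'n" and \<psi>0 :: "real^('n + 'n + 'n)" and kP tP kQ tQ cQ \<alpha> :: real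
  assumes sym: "transpose L = L" and E: "orthonormal_basis E"
    and eig: "\<And>v. v \<in> E \<Longrightarrow> L *v v = \<mu> v *\<^sub>R v" and psd: "\<And>v. v \<in> E \<Longrightarrow> 0 \<le> \<mu> v"
    and pars: "kP > 0" "tP > 0" "kQ > 0" "tQ > 0" "cQ > 0" "\<alpha> > 0"
    and \<psi>0: "state_delta \<psi>0 = 0"
  defines "A \<equiv> sysA kP tP kQ tQ cQ L"
  shows "((\<lambda>t. (norm (sysC \<alpha> L *v (mat_exp (t *\<^sub>R A) *v \<psi>0)))\<^sup>2) has_integral
    \<alpha> * (\<Sum>v\<in>E. if \<mu> v = 0 then 0 else
        tP\<^sup>2 * (v \<bullet> state_omega \<psi>0)\<^sup>2 / (2 * kP)
        + \<mu> v * tQ * (v \<bullet> state_V \<psi>0)\<^sup>2 / (2 * (cQ + kQ * \<mu> v)))) {0..}"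
proof -
  define W where "W = (\<lambda>t. mat_exp (t *\<^sub>R A) *v \<psi>0)"
  have W0: "W 0 = \<psi>0"
    by (simp add: W_def mat_exp_0 del: scaleR_zero_left)
  have W: "((\<lambda>t. W t $ i) has_field_derivative (A *v W t) $ i) (at t)" for t i
    unfolding W_def by (rule has_derivative_mat_exp_trajectory)
  have D: "((\<lambda>t. v \<bullet> state_delta (W t)) has_field_derivative v \<bullet> state_delta (A *v W t)) (at t)"
    "((\<lambda>t. v \<bullet> state_omega (W t)) has_field_derivative v \<bullet> state_omega (A *v W t)) (at t)"
    "((\<lambda>t. v \<bullet> state_V (W t)) has_field_derivative v \<bullet> state_V (A *v W t)) (at t)" for v t
    unfolding inner_vec_def state_defs inner_real_def vec_lambda_beta
    by (intro DERIV_sum DERIV_cmult W)+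
  have eig': "v \<bullet> (L *v x) = \<mu> v * (v \<bullet> x)" if "v \<in> E" for v x
    by (simp add: symmetric_matrix_selfadjoint[OF sym] eig that)
  have mode: "((\<lambda>t. \<mu> v * ((v \<bullet> state_delta (W t))\<^sup>2 + (v \<bullet> state_V (W t))\<^sup>2)) has_integral
      (if \<mu> v = 0 then 0 else tP\<^sup>2 * (v \<bullet> state_omega \<psi>0)\<^sup>2 / (2 * kP)
        + \<mu> v * tQ * (v \<bullet> state_V \<psi>0)\<^sup>2 / (2 * (cQ + kQ * \<mu> v)))) {0..}"
    if v: "v \<in> E" for v
  \<comment> \<open>The angle of a zero mode need not be square integrable; keeping the weight
    \<open>\<mu> v\<close> inside the integrand makes its contribution 0.\<close>
  proof (cases "\<mu> v = 0")
    case False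
    then have \<mu>: "\<mu> v > 0"
      using psd[OF v] by simp
    have "((\<lambda>t. (v \<bullet> state_delta (W t))\<^sup>2) has_integral
        (v \<bullet> state_omega (W 0))\<^sup>2 / (2 * (1 / tP) * (kP * \<mu> v / tP))) {0..}"
    proof (rule integral_second_order_energy)
      show "((\<lambda>t. v \<bullet> state_delta (W t)) has_field_derivative v \<bullet> state_omega (W t)) (at t)" for t
        using D(1)[of v t] by (simp add: A_def sysA_mult)
      show "((\<lambda>t. v \<bullet> state_omega (W t)) has_field_derivative
          - (kP * \<mu> v / tP) * (v \<bullet> state_delta (W t)) - 1 / tP * (v \<bullet> state_omega (W t))) (at t)" for t
        using D(2)[of v t] by (simp add: A_def sysA_mult inner_diff_right eig'[OF v] mult.assoc)
    qed (use pars \<mu> \<psi>0 W0 in auto)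
    moreover have "((\<lambda>t. (v \<bullet> state_V (W t))\<^sup>2) has_integral
        (v \<bullet> state_V (W 0))\<^sup>2 / (2 * ((cQ + kQ * \<mu> v) / tQ))) {0..}"
    proof (rule integral_first_order_energy)
      show "((\<lambda>t. v \<bullet> state_V (W t)) has_field_derivative
          - ((cQ + kQ * \<mu> v) / tQ) * (v \<bullet> state_V (W t))) (at t)" for t
        using D(3)[of v t]
        by (simp add: A_def sysA_mult inner_diff_right eig'[OF v] add_divide_distrib algebra_simps)
    qed (use pars \<mu> in \<open>auto intro!: divide_pos_pos add_pos_pos\<close>)
    ultimately have "((\<lambda>t. \<mu> v * ((v \<bullet> state_delta (W t))\<^sup>2 + (v \<bullet> state_V (W t))\<^sup>2)) has_integral
        \<mu> v * ((v \<bullet> state_omega (W 0))\<^sup>2 / (2 * (1 / tP) * (kP * \<mu> v / tP))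
          + (v \<bullet> state_V (W 0))\<^sup>2 / (2 * ((cQ + kQ * \<mu> v) / tQ)))) {0..}"
      by (intro has_integral_mult_right has_integral_add)
    moreover have "\<mu> v * ((v \<bullet> state_omega (W 0))\<^sup>2 / (2 * (1 / tP) * (kP * \<mu> v / tP))
          + (v \<bullet> state_V (W 0))\<^sup>2 / (2 * ((cQ + kQ * \<mu> v) / tQ)))
        = tP\<^sup>2 * (v \<bullet> state_omega \<psi>0)\<^sup>2 / (2 * kP)
        + \<mu> v * tQ * (v \<bullet> state_V \<psi>0)\<^sup>2 / (2 * (cQ + kQ * \<mu> v))"
      using pars \<mu> by (simp add: W0 distrib_left power2_eq_square mult_ac)
    ultimately show ?thesis
      using False by simp
  qed simp
  have out: "(norm (sysC \<alpha> L *v W t))\<^sup>2 =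
      \<alpha> * (\<Sum>v\<in>E. \<mu> v * ((v \<bullet> state_delta (W t))\<^sup>2 + (v \<bullet> state_V (W t))\<^sup>2))" for t
  proof -
    have \<mu>: "\<mu> v = v \<bullet> (L *v v)" if "v \<in> E" for v
      using E that by (auto simp: eig orthonormal_basis_def dot_square_norm)
    then have "L *v v = (v \<bullet> (L *v v)) *\<^sub>R v" "0 \<le> v \<bullet> (L *v v)" if "v \<in> E" for v
      using that eig psd by metis+
    note psd_sqrt[OF sym E this]
    then have "(norm (sysC \<alpha> L *v W t))\<^sup>2 = \<alpha> * (state_delta (W t) \<bullet> (L *v state_delta (W t))
        + state_V (W t) \<bullet> (L *v state_V (W t)))"
      using pars by (intro norm_sysC_mult) auto
    then show ?thesis
      by (simp only: quadratic_form_eigenbasis[OF sym E eig] distrib_left sum.distrib)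
  qed
  have "((\<lambda>t. (norm (sysC \<alpha> L *v W t))\<^sup>2) has_integral
    \<alpha> * (\<Sum>v\<in>E. if \<mu> v = 0 then 0 else
        tP\<^sup>2 * (v \<bullet> state_omega \<psi>0)\<^sup>2 / (2 * kP)
        + \<mu> v * tQ * (v \<bullet> state_V \<psi>0)\<^sup>2 / (2 * (cQ + kQ * \<mu> v)))) {0..}"
    unfolding out
    by (intro has_integral_mult_right has_integral_sum mode orthonormal_basis_finite_independent(1)[OF E])
  then show ?thesis
    by (simp only: W_def)
qed

text \<open>The energies are summed over all input impulses. The squared components of a unit
  \<open>v\<close> add up to 1, while the input gains \<open>1 / tP\<close> and
  \<open>1 / tQ\<close> cancel \<open>tP\<^sup>2\<close> and leave a single \<open>tQ\<close> in the
  denominator.\<close>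

theorem h2_norm_sq_modal:
  fixes L :: "real^'n::finite^'n"
  assumes sym: "transpose L = L" and E: "orthonormal_basis E"
    and eig: "\<And>v. v \<in> E \<Longrightarrow> L *v v = \<mu> v *\<^sub>R v" and psd: "\<And>v. v \<in> E \<Longrightarrow> 0 \<le> \<mu> v"
    and pars: "kP > 0" "tP > 0" "kQ > 0" "tQ > 0" "cQ > 0" "\<alpha> > 0"
  shows "h2_norm_sq (sysA kP tP kQ tQ cQ L) (sysB tP tQ) (sysC \<alpha> L) =
    \<alpha> / 2 * (\<Sum>v\<in>E. if \<mu> v = 0 then 0 else 1 / kP + \<mu> v / (tQ * (cQ + kQ * \<mu> v)))"
proof -
  let ?A = "sysA kP tP kQ tQ cQ L" and ?B = "sysB tP tQ :: real^('n + 'n)^('n + 'n + 'n)"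
  let ?e = "\<lambda>j v. if \<mu> v = 0 then 0 else
        tP\<^sup>2 * (v \<bullet> state_omega (?B *v axis j 1))\<^sup>2 / (2 * kP)
        + \<mu> v * tQ * (v \<bullet> state_V (?B *v axis j 1))\<^sup>2 / (2 * (cQ + kQ * \<mu> v))"
  have "(norm (sysC \<alpha> L ** mat_exp (t *\<^sub>R ?A) ** ?B))\<^sup>2 =
      (\<Sum>j\<in>UNIV. (norm (sysC \<alpha> L *v (mat_exp (t *\<^sub>R ?A) *v (?B *v axis j 1))))\<^sup>2)" for t
    by (simp add: norm_matrix_power2_eq_sum_columns matrix_vector_mul_assoc matrix_mul_assoc)
  then have "((\<lambda>t. (norm (sysC \<alpha> L ** mat_exp (t *\<^sub>R ?A) ** ?B))\<^sup>2) has_integral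
      (\<Sum>j\<in>UNIV. \<alpha> * (\<Sum>v\<in>E. ?e j v))) {0..}"
    using has_integral_output_energy[OF sym E eig psd pars sysB_mult_axis(1)]
    by (simp only:) (intro has_integral_sum; simp)
  then have "h2_norm_sq ?A ?B (sysC \<alpha> L) = \<alpha> * (\<Sum>v\<in>E. \<Sum>j\<in>UNIV. ?e j v)"
    unfolding h2_norm_sq_def by (subst sum.swap) (simp add: integral_unique sum_distrib_left)
  also have "(\<Sum>v\<in>E. \<Sum>j\<in>UNIV. ?e j v) =
      (\<Sum>v\<in>E. 1 / 2 * (if \<mu> v = 0 then 0 else 1 / kP + \<mu> v / (tQ * (cQ + kQ * \<mu> v))))"
  proof (rule sum.cong[OF refl])
    fix v assume v: "v \<in> E"
    have "norm v = 1"
      using E v by (simp add: orthonormal_basis_def)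
    then have unit: "(\<Sum>i\<in>UNIV. (v $ i)\<^sup>2) = 1"
      using power2_norm_eq_inner[of v] by (simp add: inner_vec_def power2_eq_square)
    have Inl: "?e (Inl i) v = (if \<mu> v = 0 then 0 else 1 / (2 * kP)) * (v $ i)\<^sup>2" for i
      using pars by (simp add: sysB_mult_axis inner_axis power_divide)
    have Inr: "?e (Inr i) v =
        (if \<mu> v = 0 then 0 else \<mu> v / (2 * tQ * (cQ + kQ * \<mu> v))) * (v $ i)\<^sup>2" for i
      using pars by (simp add: sysB_mult_axis inner_axis power_divide power2_eq_square[of tQ])
    show "(\<Sum>j\<in>UNIV. ?e j v) =
        1 / 2 * (if \<mu> v = 0 then 0 else 1 / kP + \<mu> v / (tQ * (cQ + kQ * \<mu> v)))"
      unfolding sum_UNIV_Plus Inl Inr sum_distrib_left[symmetric] unit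
      by (simp add: mult.assoc)
  qed
  finally show ?thesis
    by (simp only: sum_distrib_left[symmetric])
qed

section \<open>Laplacians\<close>

text \<open>The difference form lets the sum run over all nodes, because the term
  \<open>k = i\<close> vanishes.\<close>

lemma laplacian_mult_component:
  "(laplacian b *v x) $ i = (\<Sum>k\<in>UNIV. b i k * (x $ i - x $ k))"
proof -
  have "(laplacian b *v x) $ i = (\<Sum>j\<in>UNIV - {i}. b i j) * x $ i + (\<Sum>k\<in>UNIV - {i}. - b i k * x $ k)"
    unfolding laplacian_def matrix_vector_mult_def vec_lambda_beta
    by (subst sum.remove[of UNIV i]) auto
  also have "\<dots> = (\<Sum>k\<in>UNIV - {i}. b i k * (x $ i - x $ k))"
    by (simp add: sum_distrib_left sum_distrib_right algebra_simps sum_subtractf sum_negf)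
  also have "\<dots> = (\<Sum>k\<in>UNIV. b i k * (x $ i - x $ k))"
    by (rule sum.mono_neutral_left) auto
  finally show ?thesis .
qed

text \<open>Exchanging the summation indices and averaging symmetrises the form.\<close>

lemma laplacian_quadratic_form:
  assumes bsym: "\<And>i k. b i k = b k i"
  shows "x \<bullet> (laplacian b *v x) = (\<Sum>i\<in>UNIV. \<Sum>k\<in>UNIV. b i k * (x $ i - x $ k)\<^sup>2) / 2"
proof -
  have *: "x \<bullet> (laplacian b *v x) = (\<Sum>i\<in>UNIV. \<Sum>k\<in>UNIV. b i k * (x $ i * (x $ i - x $ k)))"
    by (simp add: inner_vec_def laplacian_mult_component sum_distrib_left ac_simps)
  also have "\<dots> = (\<Sum>i\<in>UNIV. \<Sum>k\<in>UNIV. b i k * (x $ k * (x $ k - x $ i)))"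
    by (subst sum.swap) (simp add: bsym)
  finally have **: "x \<bullet> (laplacian b *v x) = \<dots>" .
  have "x \<bullet> (laplacian b *v x) + x \<bullet> (laplacian b *v x) =
      (\<Sum>i\<in>UNIV. \<Sum>k\<in>UNIV. b i k * (x $ i - x $ k)\<^sup>2)"
    by (subst (1) *, subst **, simp add: sum.distrib[symmetric] power2_eq_square algebra_simps)
  then show ?thesis by simp
qed

lemma laplacian_transpose:
  assumes "\<And>i k. b i k = b k i"
  shows "transpose (laplacian b) = laplacian b"
  using assms by (simp add: laplacian_def transpose_def vec_eq_iff)

lemma laplacian_trace:
  "trace (laplacian b) = (\<Sum>(i, k)\<in>{(i, k). i \<noteq> k}. b i k)"
proof -
  have "{(i, k). i \<noteq> k} = (SIGMA i:UNIV. UNIV - {i :: 'a})"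
    by auto
  then show ?thesis
    by (simp add: trace_def laplacian_def sum.Sigma)
qed

text \<open>The complete graph with unit weights has Laplacian \<open>N I - J\<close>, which acts as \<open>N\<close> on vectors
  of zero sum.\<close>

lemma laplacian_quadratic_form_ge:
  fixes x :: "real^'n::finite"
  assumes bsym: "\<And>i k. b i k = b k i" and m: "\<And>i k. i \<noteq> k \<Longrightarrow> m \<le> b i k"
    and x0: "(\<Sum>i\<in>UNIV. x $ i) = 0"
  shows "real CARD('n) * m * (norm x)\<^sup>2 \<le> x \<bullet> (laplacian b *v x)"
proof -
  have nx: "(\<Sum>i\<in>UNIV. (x $ i)\<^sup>2) = (norm x)\<^sup>2"
    unfolding power2_norm_eq_inner inner_vec_def by (simp add: power2_eq_square)
  have "(\<Sum>k\<in>UNIV. (x $ i - x $ k)\<^sup>2) = real CARD('n) * (x $ i)\<^sup>2 + (norm x)\<^sup>2" for i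
  proof -
    have "(\<Sum>k\<in>UNIV. (x $ i - x $ k)\<^sup>2) =
        (\<Sum>k\<in>UNIV. (x $ i)\<^sup>2 + (x $ k)\<^sup>2 - 2 * x $ i * x $ k)"
      by (simp add: power2_diff)
    also have "\<dots> = real CARD('n) * (x $ i)\<^sup>2 + (norm x)\<^sup>2"
      by (simp add: sum.distrib sum_subtractf nx x0 flip: sum_distrib_left)
    finally show ?thesis .
  qed
  then have "2 * (real CARD('n) * m * (norm x)\<^sup>2) = (\<Sum>i\<in>UNIV. \<Sum>k\<in>UNIV. m * (x $ i - x $ k)\<^sup>2)"
    by (simp add: sum.distrib nx flip: sum_distrib_left)
  also have "\<dots> \<le> (\<Sum>i\<in>UNIV. \<Sum>k\<in>UNIV. b i k * (x $ i - x $ k)\<^sup>2)"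
  proof (intro sum_mono)
    fix i k
    show "m * (x $ i - x $ k)\<^sup>2 \<le> b i k * (x $ i - x $ k)\<^sup>2"
      using m[of i k] by (cases "i = k") (auto intro: mult_right_mono)
  qed
  finally show ?thesis
    by (simp add: laplacian_quadratic_form[OF bsym])
qed

text \<open>The constant vector spans a zero mode. Its orthogonal complement is invariant, and
  diagonalising there forces every other basis vector to have zero sum.\<close>

lemma laplacian_eigenbasis:
  fixes b :: "'n::finite \<Rightarrow> 'n \<Rightarrow> real"
  assumes bsym: "\<And>i k. b i k = b k i"
  shows "\<exists>u E. orthonormal_basis (insert u E) \<and> u \<notin> E \<and> laplacian b *v u = 0 \<and>
    (\<forall>v\<in>E. laplacian b *v v = (v \<bullet> (laplacian b *v v)) *\<^sub>R v \<and> (\<Sum>i\<in>UNIV. v $ i) = 0)"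
proof -
  let ?L = "laplacian b"
  define u :: "real^'n" where "u = (\<chi> i. 1 / sqrt (real CARD('n)))"
  define T where "T = {y. u \<bullet> y = 0}"
  have Lu: "?L *v u = 0"
    by (simp add: vec_eq_iff laplacian_mult_component u_def)
  have uu: "u \<bullet> u = 1"
    by (simp add: u_def inner_vec_def)
  have sa: "x \<bullet> (?L *v y) = (?L *v x) \<bullet> y" for x y
    by (rule symmetric_matrix_selfadjoint[OF laplacian_transpose[OF bsym]])
  have T: "subspace T"
    unfolding T_def by (rule subspace_hyperplane)
  moreover have "(*v) ?L ` T \<subseteq> T"
    by (auto simp: T_def sa Lu)
  ultimately obtain E where E: "E \<subseteq> T" "pairwise orthogonal E"
    "\<forall>v\<in>E. norm v = 1 \<and> ?L *v v = (v \<bullet> (?L *v v)) *\<^sub>R v" "span E = T"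
    using selfadjoint_orthonormal_eigenbasis[OF matrix_vector_mul_linear sa] by blast
  have "span (insert u E) = UNIV"
    using span_insert_unit_normal[OF _ _ subspace_UNIV, of u E] uu E(4) by (simp add: T_def)
  moreover have "pairwise orthogonal (insert u E)"
    using E(1,2) by (auto simp: pairwise_insert T_def orthogonal_def inner_commute)
  ultimately have "orthonormal_basis (insert u E)"
    using E(3) uu by (auto simp: orthonormal_basis_def norm_eq_1)
  moreover have "u \<notin> E"
    using E(1) uu by (auto simp: T_def)
  moreover have "(\<Sum>i\<in>UNIV. v $ i) = 0" if "v \<in> E" for v
  proof -
    have "u \<bullet> v = (\<Sum>i\<in>UNIV. v $ i) / sqrt (real CARD('n))"
      by (simp add: u_def inner_vec_def sum_divide_distrib)
    then show ?thesis
      using that E(1) by (auto simp: T_def)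
  qed
  ultimately show ?thesis
    using E(3) Lu by blast
qed

text \<open>The gain is \<open>x / (c + k * x)\<close>, with slope
  \<open>c / (c + k * m)\<^sup>2\<close> at \<open>m\<close>. Its gap below the tangent is an
  explicit nonnegative multiple of \<open>(x - m)\<^sup>2\<close>.\<close>

lemma concave_gain_tangent:
  fixes c k m x :: real
  assumes "c > 0" "k > 0" "m > 0" "x > 0"
  shows "1 / (c / x + k) \<le> 1 / (c / m + k) + c / (c + k * m)\<^sup>2 * (x - m)"
proof -
  have pos: "c + k * x > 0" "c + k * m > 0"
    using assms by (auto intro: add_pos_pos)
  have "1 / (c / m + k) + c / (c + k * m)\<^sup>2 * (x - m) - 1 / (c / x + k)
      = m / (c + k * m) + c * (x - m) / (c + k * m)\<^sup>2 - x / (c + k * x)"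
    using assms pos by (simp add: field_simps)
  also have "\<dots> = c * k * (x - m)\<^sup>2 / ((c + k * m)\<^sup>2 * (c + k * x))"
    using pos by (simp add: divide_simps) (simp add: power2_eq_square algebra_simps)
  also have "\<dots> \<ge> 0"
    using assms pos by simp
  finally show ?thesis by simp
qed

text \<open>Jensen's inequality from the tangent at the mean, where the linear terms sum to
  zero.\<close>

lemma sum_concave_gain_le:
  fixes c k m :: real
  assumes "finite E" "c > 0" "k > 0" "m > 0" "\<And>v. v \<in> E \<Longrightarrow> \<mu> v > 0"
    and mean: "(\<Sum>v\<in>E. \<mu> v) = real (card E) * m"
  shows "(\<Sum>v\<in>E. 1 / (c / \<mu> v + k)) \<le> real (card E) * (1 / (c / m + k))"
proof -
  have "(\<Sum>v\<in>E. 1 / (c / \<mu> v + k)) \<le> (\<Sum>v\<in>E. 1 / (c / m + k) + c / (c + k * m)\<^sup>2 * (\<mu> v - m))"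
    using assms by (intro sum_mono concave_gain_tangent) auto
  also have "\<dots> = real (card E) * (1 / (c / m + k)) + c / (c + k * m)\<^sup>2 * (\<Sum>v\<in>E. \<mu> v - m)"
    by (simp only: sum.distrib sum_distrib_left sum_constant)
  also have "(\<Sum>v\<in>E. \<mu> v - m) = 0"
    by (simp add: sum_subtractf mean)
  finally show ?thesis by simp
qed

section \<open>The bounds\<close>

theorem theorem3:
  fixes b :: "'n::finite \<Rightarrow> 'n \<Rightarrow> real"
    and kP tP kQ tQ bbar cQ \<alpha> :: real
  assumes N2: "CARD('n) \<ge> 2"
    and bpos: "\<And>i k. i \<noteq> k \<Longrightarrow> b i k > 0"
    and bsym: "\<And>i k. b i k = b k i"
    and pars: "kP > 0" "tP > 0" "kQ > 0" "tQ > 0" "bbar \<ge> 0" "\<alpha> > 0"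
    and cQ: "cQ = 1 + 2 * kQ * bbar"
  defines "N \<equiv> real CARD('n)"
    and "bmean \<equiv> (\<Sum>(i, k)\<in>{(i, k). i \<noteq> k}. b i k) / (real CARD('n) * (real CARD('n) - 1))"
    and "bmin \<equiv> Min {b i k | i k. i \<noteq> k}"
    and "H2 \<equiv> h2_norm_sq (sysA kP tP kQ tQ cQ (laplacian b)) (sysB tP tQ) (sysC \<alpha> (laplacian b))"
  shows "\<alpha> / 2 * (N - 1) * (1 / kP + 1 / (tQ * (cQ / (N * bmin) + kQ))) \<le> H2
       \<and> H2 \<le> \<alpha> / 2 * (N - 1) * (1 / kP + 1 / (tQ * (cQ / (N * bmean) + kQ)))
       \<and> ((\<forall>i k j l. i \<noteq> k \<longrightarrow> j \<noteq> l \<longrightarrow> b i k = b j l) \<longrightarrow>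
            H2 = \<alpha> / 2 * (N - 1) * (1 / kP + 1 / (tQ * (cQ / (N * bmin) + kQ)))
          \<and> H2 = \<alpha> / 2 * (N - 1) * (1 / kP + 1 / (tQ * (cQ / (N * bmean) + kQ))))"
proof -
  let ?L = "laplacian b"
  define lam where "lam = (\<lambda>v. v \<bullet> (?L *v v))"
  \<comment> \<open>For positive \<open>x\<close> this is \<open>x / (cQ + kQ * x)\<close>. Division
    by zero makes \<open>gain 0\<close> equal to \<open>1 / kQ\<close>, so the zero mode has to be
    removed first.\<close>
  define gain where "gain = (\<lambda>x. 1 / (cQ / x + kQ))"
  have cQ_pos: "cQ > 0"
    using cQ pars by (simp add: add_pos_nonneg)
  have N: "N \<ge> 2"
    using N2 by (simp add: N_def)
  obtain u E where E: "orthonormal_basis (insert u E)" "u \<notin> E" and Lu: "?L *v u = 0"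
    and eig: "\<forall>v\<in>E. ?L *v v = (v \<bullet> (?L *v v)) *\<^sub>R v"
    and E0: "\<forall>v\<in>E. (\<Sum>i\<in>UNIV. v $ i) = 0"
    using laplacian_eigenbasis[of b, OF bsym] by blast
  have finE: "finite E" and cardE: "real (card E) = N - 1"
    using orthonormal_basis_finite_independent(1)[OF E(1)] orthonormal_basis_card[OF E(1)] E(2)
    by (auto simp: N_def)

  have fin: "finite {b i k | i k. i \<noteq> k}"
    by (rule finite_subset[of _ "range (\<lambda>(i, k). b i k)"]) auto
  obtain i0 k0 :: 'n where ik0: "i0 \<noteq> k0"
    using N2 by (metis card_2_iff' ex_card top_greatest)
  then have bmin_in: "bmin \<in> {b i k | i k. i \<noteq> k}"
    unfolding bmin_def by (intro Min_in[OF fin]) blast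
  have bmin_le: "bmin \<le> b i k" if "i \<noteq> k" for i k
    unfolding bmin_def using that by (intro Min_le[OF fin]) blast
  have bmin_pos: "bmin > 0"
    using bmin_in bpos by auto
  \<comment> \<open>On unit vectors of zero sum, the bound on the quadratic form is a bound on the
    eigenvalue.\<close>
  have lam_ge: "N * bmin \<le> lam v" if "v \<in> E" for v
  proof -
    have "norm v = 1"
      using E(1) that by (simp add: orthonormal_basis_def)
    then show ?thesis
      using laplacian_quadratic_form_ge[where b=b, OF bsym bmin_le E0[THEN bspec, OF that]] by (simp add: N_def lam_def)
  qed
  have lam_pos: "lam v > 0" if "v \<in> E" for v
    using lam_ge[OF that] mult_pos_pos[of N bmin] N bmin_pos by linarith

  have "H2 = \<alpha> / 2 * (\<Sum>v\<in>insert u E. if lam v = 0 then 0 else 1 / kP + lam v / (tQ * (cQ + kQ * lam v)))"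
    unfolding H2_def
    using eig Lu lam_pos pars cQ_pos
    by (intro h2_norm_sq_modal[OF laplacian_transpose[of b, OF bsym] E(1)]) (auto simp: lam_def less_imp_le)
  also have "(\<Sum>v\<in>insert u E. if lam v = 0 then 0 else 1 / kP + lam v / (tQ * (cQ + kQ * lam v)))
      = (\<Sum>v\<in>E. 1 / kP + gain (lam v) / tQ)"
  proof -
    have "lam v / (tQ * (cQ + kQ * lam v)) = gain (lam v) / tQ" if "v \<in> E" for v
      using lam_pos[OF that] by (simp add: gain_def field_simps)
    moreover have "lam v \<noteq> 0" if "v \<in> E" for v
      using lam_pos[OF that] by simp
    moreover have "lam u = 0"
      by (simp add: lam_def Lu)
    ultimately show ?thesis
      using finE E(2) by (auto intro!: sum.cong)
  qed
  also have "\<dots> = (N - 1) * (1 / kP) + (\<Sum>v\<in>E. gain (lam v)) / tQ"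
    by (simp add: sum.distrib cardE sum_divide_distrib)
  finally have H2: "H2 = \<alpha> / 2 * ((N - 1) * (1 / kP) + (\<Sum>v\<in>E. gain (lam v)) / tQ)" .
  \<comment> \<open>Both claimed bounds take the shape of \<open>H2\<close>, so that only sums of
    gains remain to be compared.\<close>
  have bound: "\<alpha> / 2 * (N - 1) * (1 / kP + 1 / (tQ * (cQ / (N * x) + kQ))) =
      \<alpha> / 2 * ((N - 1) * (1 / kP) + (N - 1) * gain (N * x) / tQ)" for x
  proof -
    have "1 / (tQ * (cQ / (N * x) + kQ)) = gain (N * x) / tQ"
      by (simp add: gain_def mult.commute)
    then show ?thesis
      by (simp only: distrib_left mult.assoc times_divide_eq_right)
  qed

  have lower: "(N - 1) * gain (N * bmin) \<le> (\<Sum>v\<in>E. gain (lam v))"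
  proof -
    have "gain (N * bmin) \<le> gain (lam v)" if "v \<in> E" for v
    proof -
      have "cQ / lam v \<le> cQ / (N * bmin)"
        using lam_ge[OF that] cQ_pos N bmin_pos by (intro divide_left_mono) (auto simp: lam_pos that)
      moreover have "0 < cQ / lam v" "0 < cQ / (N * bmin)"
        using lam_pos[OF that] cQ_pos N bmin_pos by simp_all
      ultimately show ?thesis
        unfolding gain_def using pars
        by (intro divide_left_mono mult_pos_pos add_pos_pos) linarith+
    qed
    then show ?thesis
      using sum_mono[of E "\<lambda>_. gain (N * bmin)"] by (simp add: cardE)
  qed

  \<comment> \<open>There are \<open>N * (N - 1)\<close> ordered pairs and each edge occurs twice,
    so \<open>bmean\<close> is the mean over the edges.\<close>
  have sum_b: "(\<Sum>(i, k)\<in>{(i, k). i \<noteq> k}. b i k) = N * (N - 1) * bmean"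
    using N by (simp add: bmean_def N_def)
  \<comment> \<open>The zero mode adds nothing, and including it completes the basis, so the sum is
    the trace.\<close>
  have "(\<Sum>v\<in>E. lam v) = (\<Sum>v\<in>insert u E. v \<bullet> (?L *v v))"
    using finE E(2) by (simp add: lam_def Lu)
  also have "\<dots> = N * (N - 1) * bmean"
    by (simp only: trace_eq_sum_quadratic_form[OF E(1)] laplacian_trace sum_b)
  finally have sum_lam: "(\<Sum>v\<in>E. lam v) = real (card E) * (N * bmean)"
    by (simp add: cardE mult_ac)
  have "E \<noteq> {}"
    using cardE N by auto
  then have "0 < (\<Sum>v\<in>E. lam v)"
    using finE lam_pos by (intro sum_pos) auto
  then have "N * bmean > 0"
    using N unfolding sum_lam cardE by (simp add: zero_less_mult_iff)
  then have upper: "(\<Sum>v\<in>E. gain (lam v)) \<le> (N - 1) * gain (N * bmean)"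
    using sum_concave_gain_le[OF finE cQ_pos pars(3) _ lam_pos sum_lam] by (simp add: gain_def cardE)

  have lower': "\<alpha> / 2 * (N - 1) * (1 / kP + 1 / (tQ * (cQ / (N * bmin) + kQ))) \<le> H2"
    and upper': "H2 \<le> \<alpha> / 2 * (N - 1) * (1 / kP + 1 / (tQ * (cQ / (N * bmean) + kQ)))"
    unfolding bound H2 using lower upper pars
    by (auto intro!: mult_left_mono add_left_mono divide_right_mono)
  have bmean_eq: "bmean = bmin" if eq: "\<forall>i k j l. i \<noteq> k \<longrightarrow> j \<noteq> l \<longrightarrow> b i k = b j l"
  proof -
    have "b i k = bmin" if "i \<noteq> k" for i k
      using bmin_in eq that by blast
    then have "N * (N - 1) * bmean = (\<Sum>(i, k)\<in>{(i :: 'n, k). i \<noteq> k}. bmin)"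
      unfolding sum_b[symmetric] by (intro sum.cong) auto
    also have "\<dots> = N * (N - 1) * bmin"
    proof -
      have "{(i :: 'n, k). i \<noteq> k} = (SIGMA i:UNIV. UNIV - {i})"
        by auto
      then show ?thesis
        using N by (simp add: N_def card_Diff_singleton of_nat_diff)
    qed
    finally show ?thesis
      using N by simp
  qed
  \<comment> \<open>For equal susceptances the two bounds coincide and squeeze
    \<open>H2\<close>.\<close>
  have "H2 = \<alpha> / 2 * (N - 1) * (1 / kP + 1 / (tQ * (cQ / (N * bmin) + kQ)))
      \<and> H2 = \<alpha> / 2 * (N - 1) * (1 / kP + 1 / (tQ * (cQ / (N * bmean) + kQ)))"
    if eq: "\<forall>i k j l. i \<noteq> k \<longrightarrow> j \<noteq> l \<longrightarrow> b i k = b j l"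
    using order_antisym[OF upper'[unfolded bmean_eq[OF eq]] lower'] by (simp only: bmean_eq[OF eq] simp_thms)
  then show ?thesis
    using lower' upper' by blast
qed

end
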